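(* Let $\alpha,\beta$ be positive integers and consider the preferential growth urn $\mathcal{A}(\alpha,\beta)$ started from $0$ black balls and $1$ white ball. Let $H(x,y,z)=\sum_{n,i,j} H_n(0,1;i,j)\,x^i y^j \frac{z^n}{n!}$ be its exponential generating function of histories and set $H(x,z):=H(x,1,z)$. Then $H(x,z)$ is algebraic: $y=H(x,z)$ is a root of the polynomial equation $$(z-A-B_x)\,y^{2\alpha+\beta}+B_x\,y^{\alpha}+A=0,\qquad\text{where } A:=\frac{1}{2\alpha+\beta},\quad B_x:=\frac{x^{-\alpha}-1}{\alpha+\beta}.$$
   Context: A two-colour Pólya urn contains black and white balls and has a rule matrix $\begin{pmatrix} a&b\\ c&d\end{pmatrix}$ with integer entries. At each step a ball is drawn uniformly at random from the urn, its colour is observed and it is put back; if it is black, $a$ black and $b$ white balls are added, if it is white, $c$ black and $d$ white balls are added. The preferential growth urn $\mathcal{A}(\alpha,\beta)$ is the urn with rule matrix $\begin{pmatrix}2\alpha&\beta\\ \alpha&\alpha+\beta\end{pmatrix}$, $\alpha,\beta>0$; it is balanced, i.e. exactly $\sigma=2\alpha+\beta$ balls are added at every step. A history of length $n$ is a sequence of $n$ successive draws; $H_n(a_0,b_0;i,j)$ denotes the number of histories of length $n$ starting from the configuration with $a_0$ black and $b_0$ white balls and ending at the configuration with $i$ black and $j$ white balls (balls are regarded as distinguishable, so histories are counted as sequences of individual ball choices). *)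

theory Defs
  imports
    "HOL-Library.Groups_Big_Fun"
    "HOL-Computational_Algebra.Computational_Algebra"
begin

datatype colour = Black | White

text \<open>
  A rule matrix is given by its two rows, a configuration by the numbers of black and white balls.
  Configurations are integer pairs because rule matrices may have negative entries.
\<close>

type_synonym urn_rule = "(int \<times> int) \<times> (int \<times> int)"
type_synonym config = "int \<times> int"

fun balls :: "config \<Rightarrow> colour \<Rightarrow> int" where
  "balls (p, q) Black = p"
| "balls (p, q) White = q"

fun urn_step :: "urn_rule \<Rightarrow> config \<Rightarrow> colour \<Rightarrow> config" where
  "urn_step ((a, b), (c, d)) (p, q) Black = (p + a, q + b)"
| "urn_step ((a, b), (c, d)) (p, q) White = (p + c, q + d)"

text \<open>
  Balls are distinguishable: the balls of each colour present at the time of a draw are numbered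
  \<open>0, 1, 2, \<dots>\<close>, and a draw records the colour and the number of the chosen ball.
\<close>

type_synonym draw = "colour \<times> nat"

fun is_history :: "urn_rule \<Rightarrow> config \<Rightarrow> draw list \<Rightarrow> bool" where
  "is_history R s [] \<longleftrightarrow> True"
| "is_history R s ((c, k) # ds) \<longleftrightarrow> int k < balls s c \<and> is_history R (urn_step R s c) ds"

definition end_config :: "urn_rule \<Rightarrow> config \<Rightarrow> draw list \<Rightarrow> config" where
  "end_config R s ds = foldl (urn_step R) s (map fst ds)"

definition hist_count :: "urn_rule \<Rightarrow> nat \<Rightarrow> config \<Rightarrow> config \<Rightarrow> nat" where
  "hist_count R n s t = card {ds. length ds = n \<and> is_history R s ds \<and> end_config R s ds = t}"

text \<open>
  The trivariate exponential generating function of histories started in \<open>s\<close>, as a power series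
  in \<open>z\<close> whose coefficients are polynomials in \<open>y\<close> over \<open>\<rat>[x]\<close>.  Each coefficient is a sum with
  finite support, see \<open>finite_support_hist\<close> below.
\<close>

definition hist_egf :: "urn_rule \<Rightarrow> config \<Rightarrow> rat poly poly fps" where
  "hist_egf R s = Abs_fps (\<lambda>n. \<Sum>(i, j).
     monom (monom (of_nat (hist_count R n s (int i, int j)) / fact n) i) j)"

definition fps_map :: "('a \<Rightarrow> 'b) \<Rightarrow> 'a fps \<Rightarrow> 'b fps" where
  "fps_map f F = Abs_fps (\<lambda>n. f (fps_nth F n))"

definition pref_growth_urn :: "nat \<Rightarrow> nat \<Rightarrow> urn_rule" where
  "pref_growth_urn \<alpha> \<beta> = ((2 * int \<alpha>, int \<beta>), (int \<alpha>, int \<alpha> + int \<beta>))"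

text \<open>The specialisation \<open>H(x, 1, z)\<close> for the urn started with no black and one white ball.\<close>

definition pref_growth_egf :: "nat \<Rightarrow> nat \<Rightarrow> rat poly fps" where
  "pref_growth_egf \<alpha> \<beta> = fps_map (\<lambda>p. poly p 1) (hist_egf (pref_growth_urn \<alpha> \<beta>) (0, 1))"

text \<open>
  For a series in \<open>z\<close> over \<open>R\<close>: being a root of a non-zero polynomial with coefficients in \<open>R[z]\<close>.
  For \<open>R = \<rat>[x]\<close> this is algebraicity over \<open>\<rat>(x, z)\<close>, by clearing denominators.
\<close>

definition algebraic_fps :: "'a :: idom fps \<Rightarrow> bool" where
  "algebraic_fps F \<longleftrightarrow> (\<exists>P :: 'a poly poly. P \<noteq> 0 \<and> poly (map_poly fps_of_poly P) F = 0)"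

lemma finite_histories: "finite {ds. length ds = n \<and> is_history R s ds}"
proof (induction n arbitrary: s)
  case 0
  have "{ds. length ds = 0 \<and> is_history R s ds} \<subseteq> {[]}"
    by auto
  then show ?case
    by (rule finite_subset) simp
next
  case (Suc n)
  let ?D = "{Black} \<times> {..<nat (balls s Black)} \<union> {White} \<times> {..<nat (balls s White)}"
  let ?T = "\<lambda>c. {ds. length ds = n \<and> is_history R (urn_step R s c) ds}"
  have "{ds. length ds = Suc n \<and> is_history R s ds} \<subseteq>
          (\<lambda>(d, ds). d # ds) ` (?D \<times> (?T Black \<union> ?T White))"
  proof
    fix ds
    assume "ds \<in> {ds. length ds = Suc n \<and> is_history R s ds}"
    then obtain c k es where "ds = (c, k) # es" "length es = n" "int k < balls s c"
        "is_history R (urn_step R s c) es"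
      by (cases ds) auto
    then show "ds \<in> (\<lambda>(d, ds). d # ds) ` (?D \<times> (?T Black \<union> ?T White))"
      by (cases c) (auto simp: image_iff zless_nat_eq_int_zless)
  qed
  moreover have "finite ((\<lambda>(d, ds). d # ds) ` (?D \<times> (?T Black \<union> ?T White)))"
    using Suc.IH by simp
  ultimately show ?case
    by (rule finite_subset)
qed

lemma finite_support_hist: "finite {(i, j). hist_count R n s (int i, int j) \<noteq> 0}"
proof (rule finite_subset)
  let ?E = "end_config R s ` {ds. length ds = n \<and> is_history R s ds}"
  show "{(i, j). hist_count R n s (int i, int j) \<noteq> 0} \<subseteq> (\<lambda>(i, j). (nat i, nat j)) ` ?E"
  proof
    fix t
    assume "t \<in> {(i, j). hist_count R n s (int i, int j) \<noteq> 0}"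
    then obtain i j where t: "t = (i, j)" and "hist_count R n s (int i, int j) \<noteq> 0"
      by auto
    from this(2) have "{ds. length ds = n \<and> is_history R s ds \<and> end_config R s ds = (int i, int j)} \<noteq> {}"
      unfolding hist_count_def by (metis card.empty)
    then obtain ds where "length ds = n" "is_history R s ds" "end_config R s ds = (int i, int j)"
      by blast
    then have "(int i, int j) \<in> ?E"
      by (intro image_eqI[where x = ds]) simp_all
    then have "(\<lambda>(i, j). (nat i, nat j)) (int i, int j) \<in> (\<lambda>(i, j). (nat i, nat j)) ` ?E"
      by (rule imageI)
    then show "t \<in> (\<lambda>(i, j). (nat i, nat j)) ` ?E"
      by (simp add: t)
  qed
  show "finite ((\<lambda>(i, j). (nat i, nat j)) ` ?E)"
    by (intro finite_imageI finite_histories)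
qed

end

theory Submission
  imports Defs
begin

text \<open>
  Classifying histories by their last draw, and using that the urn holds \<open>1 + (2\<alpha> + \<beta>) n\<close> balls
  after \<open>n\<close> draws to eliminate the number of white balls, gives the linear first-order equation
  \<open>L H = x\<^bsup>\<alpha>\<^esup> H\<close> with \<open>L = (1 - (2\<alpha> + \<beta>) x\<^bsup>\<alpha>\<^esup> z) \<partial>\<^sub>z - (x\<^bsup>2\<alpha>\<^esup> - x\<^bsup>\<alpha>\<^esup>) x \<partial>\<^sub>x\<close>.  Since \<open>L\<close> is a
  derivation, \<open>L H\<^sup>k = k x\<^bsup>\<alpha>\<^esup> H\<^sup>k\<close>, and the left-hand side \<open>G\<close> of the claimed algebraic equation
  satisfies \<open>L G = 0\<close>.  As \<open>G\<close> vanishes at \<open>z = 0\<close>, it vanishes identically.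
\<close>

section \<open>Histories by their last draw\<close>

abbreviation histories :: "urn_rule \<Rightarrow> config \<Rightarrow> nat \<Rightarrow> draw list set" where
  "histories R s n \<equiv> {ds. length ds = n \<and> is_history R s ds}"

text \<open>A negative number of balls of a colour contributes no draw, which is why
  \<open>nat\<close> appears in the counts below.\<close>

definition draws :: "config \<Rightarrow> draw set" where
  "draws t = {(c, k). int k < balls t c}"

lemma draws_eq:
  "draws t = Pair Black ` {..<nat (fst t)} \<union> Pair White ` {..<nat (snd t)}"
proof -
  have "(c, k) \<in> draws t \<longleftrightarrow>
      (c, k) \<in> Pair Black ` {..<nat (fst t)} \<union> Pair White ` {..<nat (snd t)}" for c k
    by (cases t; cases c) (auto simp: draws_def zless_nat_eq_int_zless)
  then show ?thesis
    by auto
qed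

lemma finite_draws: "finite (draws t)"
  by (simp add: draws_eq)

lemma sum_draws:
  fixes g :: "config \<Rightarrow> 'a :: comm_semiring_1"
  shows "(\<Sum>d\<in>draws t. g (urn_step R t (fst d))) =
    of_nat (nat (fst t)) * g (urn_step R t Black) + of_nat (nat (snd t)) * g (urn_step R t White)"
  unfolding draws_eq
  by (subst sum.union_disjoint) (auto simp: sum.reindex inj_on_def)

lemma end_config_Nil: "end_config R s [] = s"
  by (simp add: end_config_def)

lemma end_config_snoc: "end_config R s (ds @ [d]) = urn_step R (end_config R s ds) (fst d)"
  by (simp add: end_config_def)

text \<open>\<open>is_history\<close> recurses on the first draw; induction on the list moves the
  recursion to the last draw, whose admissibility depends only on the configuration reached before
  it.\<close>

lemma is_history_snoc:
  "is_history R s (ds @ [d]) \<longleftrightarrow> is_history R s ds \<and> d \<in> draws (end_config R s ds)"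
proof (induction ds arbitrary: s)
  case Nil
  then show ?case
    by (cases d) (simp add: draws_def end_config_def)
next
  case (Cons e ds)
  then show ?case
    by (cases e) (simp add: end_config_def)
qed

text \<open>Appending a draw is a bijection from pairs of a history and an admissible next draw onto
  the histories that are longer by one.\<close>

lemma sum_histories_Suc:
  "(\<Sum>ds\<in>histories R s (Suc n). f ds) =
    (\<Sum>ds\<in>histories R s n. \<Sum>d\<in>draws (end_config R s ds). f (ds @ [d]))"
proof -
  let ?S = "SIGMA ds:histories R s n. draws (end_config R s ds)"
  have "bij_betw (\<lambda>(ds, d). ds @ [d]) ?S (histories R s (Suc n))"
  proof (rule bij_betw_imageI)
    show "inj_on (\<lambda>(ds, d). ds @ [d]) ?S"
      by (auto simp: inj_on_def)
    show "(\<lambda>(ds, d). ds @ [d]) ` ?S = histories R s (Suc n)"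
    proof
      show "(\<lambda>(ds, d). ds @ [d]) ` ?S \<subseteq> histories R s (Suc n)"
        by (auto simp: is_history_snoc)
      show "histories R s (Suc n) \<subseteq> (\<lambda>(ds, d). ds @ [d]) ` ?S"
      proof
        fix es
        assume es: "es \<in> histories R s (Suc n)"
        then have "es \<noteq> []"
          by auto
        then obtain ds d where eq: "es = ds @ [d]"
          by (metis append_butlast_last_id)
        with es have "(ds, d) \<in> ?S"
          by (auto simp: is_history_snoc)
        then show "es \<in> (\<lambda>(ds, d). ds @ [d]) ` ?S"
          unfolding eq by (rule rev_image_eqI) simp
      qed
    qed
  qed
  then have "(\<Sum>ds\<in>histories R s (Suc n). f ds) = (\<Sum>p\<in>?S. f (fst p @ [snd p]))"
    using sum.reindex_bij_betw[of "\<lambda>(ds, d). ds @ [d]" ?S _ f] by (simp add: case_prod_beta)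
  also have "\<dots> = (\<Sum>ds\<in>histories R s n. \<Sum>d\<in>draws (end_config R s ds). f (ds @ [d]))"
    by (subst sum.Sigma) (auto simp: finite_histories finite_draws case_prod_beta)
  finally show ?thesis .
qed

text \<open>At \<open>y = 1\<close> only the final number of black balls is recorded, so the sum
  over end configurations unfolds, fibre by fibre, into a sum over histories. Non-negativity makes
  \<open>nat\<close> faithful on end configurations.\<close>

lemma poly_hist_egf_nth:
  assumes nonneg: "\<And>ds. ds \<in> histories R s n \<Longrightarrow>
      0 \<le> fst (end_config R s ds) \<and> 0 \<le> snd (end_config R s ds)"
  shows "poly (fps_nth (hist_egf R s) n) 1 =
    smult (1 / fact n) (\<Sum>ds\<in>histories R s n. monom 1 (nat (fst (end_config R s ds))))"
proof -
  let ?H = "histories R s n"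
  let ?e = "\<lambda>ds. (nat (fst (end_config R s ds)), nat (snd (end_config R s ds)))"
  let ?c = "\<lambda>i j. hist_count R n s (int i, int j)"
  let ?g = "\<lambda>(i, j). monom (monom (of_nat (?c i j) / fact n :: rat) i) j"
  have fibre: "?c i j = card {ds \<in> ?H. ?e ds = (i, j)}" for i j
  proof -
    have "end_config R s ds = (int i, int j) \<longleftrightarrow> ?e ds = (i, j)" if "ds \<in> ?H" for ds
      using nonneg[OF that] by (cases "end_config R s ds") auto
    then have "{ds. length ds = n \<and> is_history R s ds \<and> end_config R s ds = (int i, int j)} =
        {ds \<in> ?H. ?e ds = (i, j)}"
      by blast
    then show ?thesis
      by (simp add: hist_count_def)
  qed
  \<comment> \<open>The image of the finite set of histories contains the support, which turns the
    unrestricted sum in \<open>hist_egf\<close> into a finite one.\<close>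
  have support: "{p. ?g p \<noteq> 0} \<subseteq> ?e ` ?H"
  proof
    fix p
    assume p: "p \<in> {p. ?g p \<noteq> 0}"
    obtain i j where ij: "p = (i, j)"
      by fastforce
    have "?c i j \<noteq> 0"
      using p by (auto simp: ij)
    then have "{ds \<in> ?H. ?e ds = (i, j)} \<noteq> {}"
      unfolding fibre by (metis card.empty)
    then show "p \<in> ?e ` ?H"
      unfolding ij by (auto simp: image_iff)
  qed
  have "fps_nth (hist_egf R s) n = (\<Sum>p\<in>?e ` ?H. ?g p)"
    unfolding hist_egf_def fps_nth_Abs_fps
    by (rule Sum_any.expand_superset[OF _ support]) (simp add: finite_histories)
  then have "poly (fps_nth (hist_egf R s) n) 1 = (\<Sum>p\<in>?e ` ?H. poly (?g p) 1)"
    by (simp add: poly_sum)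
  also have "\<dots> = (\<Sum>p\<in>?e ` ?H. \<Sum>ds | ds \<in> ?H \<and> ?e ds = p. smult (1 / fact n) (monom 1 (fst (?e ds))))"
  proof (rule sum.cong)
    fix p
    assume "p \<in> ?e ` ?H"
    obtain i j where ij: "p = (i, j)"
      by fastforce
    have "(\<Sum>ds | ds \<in> ?H \<and> ?e ds = p. smult (1 / fact n) (monom 1 (fst (?e ds)))) =
        (\<Sum>ds | ds \<in> ?H \<and> ?e ds = p. monom (1 / fact n :: rat) i)"
      by (rule sum.cong) (auto simp: ij smult_monom)
    also have "\<dots> = poly (?g p) 1"
      unfolding ij by (simp add: fibre poly_monom of_nat_poly smult_monom)
    finally show "poly (?g p) 1 =
        (\<Sum>ds | ds \<in> ?H \<and> ?e ds = p. smult (1 / fact n) (monom 1 (fst (?e ds))))" ..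
  qed simp
  also have "\<dots> = (\<Sum>ds\<in>?H. smult (1 / fact n) (monom 1 (fst (?e ds))))"
    by (rule sum.image_gen[symmetric]) (rule finite_histories)
  also have "\<dots> = smult (1 / fact n) (\<Sum>ds\<in>?H. monom 1 (nat (fst (end_config R s ds))))"
    using sum_distrib_left[of "[:1 / fact n:]" "\<lambda>ds. monom (1 :: rat) (fst (?e ds))" ?H] by simp
  finally show ?thesis .
qed

section \<open>The preferential growth urn\<close>

text \<open>Balance: a draw of either colour adds \<open>2 * \<alpha> + \<beta>\<close> balls. The
  numbers of both colours also stay non-negative.\<close>

lemma end_config_pref_growth:
  "\<exists>p q. end_config (pref_growth_urn \<alpha> \<beta>) (0, 1) ds = (int p, int q) \<and>
    p + q = 1 + (2 * \<alpha> + \<beta>) * length ds"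
proof (induction ds rule: rev_induct)
  case Nil
  show ?case
    by (intro exI[of _ 0] exI[of _ 1]) (simp add: end_config_Nil)
next
  case (snoc d ds)
  then obtain p q where
    pq: "end_config (pref_growth_urn \<alpha> \<beta>) (0, 1) ds = (int p, int q)"
      "p + q = 1 + (2 * \<alpha> + \<beta>) * length ds"
    by blast
  show ?case
  proof (cases "fst d")
    case Black
    then show ?thesis
      using pq by (intro exI[of _ "p + 2 * \<alpha>"] exI[of _ "q + \<beta>"])
        (simp add: end_config_snoc pref_growth_urn_def)
  next
    case White
    then show ?thesis
      using pq by (intro exI[of _ "p + \<alpha>"] exI[of _ "q + (\<alpha> + \<beta>)"])
        (simp add: end_config_snoc pref_growth_urn_def)
  qed
qed

text \<open>This is \<open>fact n\<close> times the coefficient of \<open>z ^ n\<close> in H(x,1,z);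
  without the factorial the recurrence in \<open>n\<close> has integer coefficients.\<close>

definition pref_growth_sum :: "nat \<Rightarrow> nat \<Rightarrow> nat \<Rightarrow> rat poly" where
  "pref_growth_sum \<alpha> \<beta> n = (\<Sum>ds\<in>histories (pref_growth_urn \<alpha> \<beta>) (0, 1) n.
     monom 1 (nat (fst (end_config (pref_growth_urn \<alpha> \<beta>) (0, 1) ds))))"

lemma pref_growth_egf_nth:
  "fps_nth (pref_growth_egf \<alpha> \<beta>) n = smult (1 / fact n) (pref_growth_sum \<alpha> \<beta> n)"
proof -
  have "0 \<le> fst (end_config (pref_growth_urn \<alpha> \<beta>) (0, 1) ds) \<and>
      0 \<le> snd (end_config (pref_growth_urn \<alpha> \<beta>) (0, 1) ds)" for ds
    using end_config_pref_growth[of \<alpha> \<beta> ds] by auto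
  then show ?thesis
    unfolding pref_growth_egf_def fps_map_def fps_nth_Abs_fps pref_growth_sum_def
    by (intro poly_hist_egf_nth)
qed

lemma pref_growth_sum_0: "pref_growth_sum \<alpha> \<beta> 0 = 1"
proof -
  have "histories (pref_growth_urn \<alpha> \<beta>) (0, 1) 0 = {[]}"
    by auto
  then show ?thesis
    by (simp add: pref_growth_sum_def end_config_Nil)
qed

text \<open>The Euler operator x d/dx expresses the weight \<open>p\<close>, the number of ways to
  draw a black ball.\<close>

lemma X_times_pderiv_monom:
  "monom 1 1 * pderiv (monom 1 p) = (of_nat p * monom 1 p :: 'a :: idom poly)"
  by (cases p) (simp_all add: pderiv_monom mult_monom of_nat_poly smult_monom)

lemma pderiv_sum: "pderiv (\<Sum>i\<in>I. f i) = (\<Sum>i\<in>I. pderiv (f i))"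
  using higher_pderiv_sum[of 1 f I] by simp

text \<open>One draw from \<open>p\<close> black and \<open>q\<close> white balls replaces
  \<open>x ^ p\<close> by \<open>p * x ^ (p + 2 * \<alpha>) + q * x ^ (p + \<alpha>)\<close>.
  Balance fixes \<open>p + q\<close>, so \<open>q\<close> is eliminated, and the remaining factor
  \<open>p\<close> comes from the Euler operator.\<close>

lemma pref_growth_sum_Suc:
  "pref_growth_sum \<alpha> \<beta> (Suc n) =
    of_nat (1 + (2 * \<alpha> + \<beta>) * n) * monom 1 \<alpha> * pref_growth_sum \<alpha> \<beta> n +
    (monom 1 (2 * \<alpha>) - monom 1 \<alpha>) * monom 1 1 * pderiv (pref_growth_sum \<alpha> \<beta> n)"
proof -
  let ?R = "pref_growth_urn \<alpha> \<beta>"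
  let ?H = "histories ?R (0, 1) n"
  let ?m = "\<lambda>t :: config. monom 1 (nat (fst t)) :: rat poly"
  let ?e = "end_config ?R (0, 1)"
  have step: "(\<Sum>d\<in>draws (?e ds). ?m (urn_step ?R (?e ds) (fst d))) =
      of_nat (1 + (2 * \<alpha> + \<beta>) * n) * monom 1 \<alpha> * ?m (?e ds) +
      (monom 1 (2 * \<alpha>) - monom 1 \<alpha>) * (monom 1 1 * pderiv (?m (?e ds)))"
    if "ds \<in> ?H" for ds
  proof -
    obtain p q where e: "?e ds = (int p, int q)" and "p + q = 1 + (2 * \<alpha> + \<beta>) * length ds"
      using end_config_pref_growth by blast
    then have pq: "1 + (2 * \<alpha> + \<beta>) * n = p + q"
      using that by simp
    have "(\<Sum>d\<in>draws (?e ds). ?m (urn_step ?R (?e ds) (fst d))) =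
        of_nat p * ?m (urn_step ?R (?e ds) Black) + of_nat q * ?m (urn_step ?R (?e ds) White)"
      by (subst sum_draws) (simp add: e)
    also have "\<dots> = of_nat p * monom 1 (p + 2 * \<alpha>) + of_nat q * monom 1 (p + \<alpha>)"
      unfolding e by (simp add: pref_growth_urn_def nat_add_distrib nat_mult_distrib)
    also have "\<dots> = of_nat p * (monom 1 (2 * \<alpha>) * monom 1 p) + of_nat q * (monom 1 \<alpha> * monom 1 p)"
      by (simp add: mult_monom add.commute)
    also have "\<dots> = of_nat (p + q) * monom 1 \<alpha> * monom 1 p +
        (monom 1 (2 * \<alpha>) - monom 1 \<alpha>) * (of_nat p * monom 1 p)"
      by (simp add: algebra_simps)
    finally show ?thesis
      unfolding X_times_pderiv_monom pq by (simp add: e)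
  qed
  show ?thesis
    unfolding pref_growth_sum_def sum_histories_Suc end_config_snoc pderiv_sum mult.assoc
      sum_distrib_left sum.distrib[symmetric]
    by (rule sum.cong) (use step in \<open>simp_all add: mult.assoc\<close>)
qed

section \<open>Derivations of power series over polynomials\<close>

lemma fps_map_nth [simp]: "fps_nth (fps_map f F) n = f (fps_nth F n)"
  by (simp add: fps_map_def)

text \<open>Each coefficient of a product is a finite sum of products, so the product rule for
  polynomials carries over to differentiation in x.\<close>

lemma fps_map_pderiv_mult:
  "fps_map pderiv (F * G) = fps_map pderiv F * G + F * fps_map pderiv G"
  by (rule fps_ext)
    (simp add: fps_mult_nth pderiv_sum pderiv_mult sum.distrib[symmetric]
      add.commute mult.commute[of "pderiv _"])

text \<open>With \<open>s = (2\<alpha> + \<beta>) x\<^bsup>\<alpha>\<^esup>\<close> and \<open>v = (x\<^bsup>2\<alpha>\<^esup> - x\<^bsup>\<alpha>\<^esup>) x\<close> this is the operator \<open>L\<close> of the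
  differential equation \<open>L H = x\<^bsup>\<alpha>\<^esup> H\<close>.\<close>

definition urn_deriv :: "'a :: idom poly \<Rightarrow> 'a poly \<Rightarrow> 'a poly fps \<Rightarrow> 'a poly fps" where
  "urn_deriv s v F = (1 - fps_const s * fps_X) * fps_deriv F - fps_const v * fps_map pderiv F"

lemma urn_deriv_add: "urn_deriv s v (F + G) = urn_deriv s v F + urn_deriv s v G"
proof -
  have "fps_map pderiv (F + G) = fps_map pderiv F + fps_map pderiv G"
    by (rule fps_ext) (simp add: pderiv_add)
  then show ?thesis
    by (simp add: urn_deriv_def algebra_simps)
qed

lemma urn_deriv_mult: "urn_deriv s v (F * G) = urn_deriv s v F * G + F * urn_deriv s v G"
  by (simp add: urn_deriv_def fps_map_pderiv_mult algebra_simps)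

lemma urn_deriv_const: "urn_deriv s v (fps_const c) = - fps_const (v * pderiv c)"
proof -
  have "fps_map pderiv (fps_const c) = fps_const (pderiv c)"
    by (rule fps_ext) simp
  then show ?thesis
    by (simp add: urn_deriv_def)
qed

lemma urn_deriv_X: "urn_deriv s v fps_X = 1 - fps_const s * fps_X"
proof -
  have "fps_map pderiv fps_X = (0 :: 'a poly fps)"
    by (rule fps_ext) (simp add: fps_X_def)
  then show ?thesis
    by (simp add: urn_deriv_def)
qed

text \<open>Eigenvalues of a derivation add up under multiplication of eigenvectors.\<close>

lemma urn_deriv_power:
  assumes "urn_deriv s v F = fps_const u * F"
  shows "urn_deriv s v (F ^ k) = of_nat k * fps_const u * F ^ k"
proof (induction k)
  case 0
  show ?case
    using urn_deriv_const[of s v 1] by simp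
next
  case (Suc k)
  show ?case
    by (simp add: urn_deriv_mult assms Suc algebra_simps)
qed

lemma urn_deriv_nth:
  "fps_nth (urn_deriv s v F) n =
    of_nat (Suc n) * fps_nth F (Suc n) - of_nat n * s * fps_nth F n - v * pderiv (fps_nth F n)"
  by (cases n) (simp_all add: urn_deriv_def algebra_simps)

text \<open>Comparing coefficients of \<open>z ^ n\<close> expresses
  \<open>of_nat (Suc n) * fps_nth G (Suc n)\<close> through \<open>fps_nth G n\<close> and its
  derivative, so in characteristic 0 vanishing propagates from each coefficient to the next.\<close>

lemma urn_deriv_eigen_eq_0:
  fixes G :: "'a :: {idom, ring_char_0} poly fps"
  assumes "urn_deriv s v G = fps_const c * G" and "fps_nth G 0 = 0"
  shows "G = 0"
proof (rule fps_ext)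
  fix n
  show "fps_nth G n = fps_nth 0 n"
  proof (induction n)
    case 0
    show ?case
      using assms(2) by simp
  next
    case (Suc n)
    have "fps_nth (urn_deriv s v G) n = c * fps_nth G n"
      by (simp add: assms(1))
    then have "of_nat (Suc n) * fps_nth G (Suc n) = 0"
      using Suc unfolding urn_deriv_nth by simp
    then show ?case
      using of_nat_neq_0[where 'a = "'a poly", of n] by simp
  qed
qed

section \<open>The algebraic equation\<close>

text \<open>On coefficients of \<open>z ^ n\<close> this is the recurrence
  \<open>pref_growth_sum_Suc\<close> divided by \<open>fact n\<close>.\<close>

lemma urn_deriv_pref_growth_egf:
  "urn_deriv (of_nat (2 * \<alpha> + \<beta>) * monom 1 \<alpha>) ((monom 1 (2 * \<alpha>) - monom 1 \<alpha>) * monom 1 1)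
     (pref_growth_egf \<alpha> \<beta>) = fps_const (monom 1 \<alpha>) * pref_growth_egf \<alpha> \<beta>"
proof (rule fps_ext)
  fix n
  let ?h = "pref_growth_sum \<alpha> \<beta>"
  let ?s = "of_nat (2 * \<alpha> + \<beta>) * monom 1 \<alpha> :: rat poly"
  let ?v = "(monom 1 (2 * \<alpha>) - monom 1 \<alpha>) * monom 1 1 :: rat poly"
  have "of_nat (Suc n) * smult (1 / fact (Suc n)) (?h (Suc n)) = smult (1 / fact n) (?h (Suc n))"
    by (simp add: of_nat_poly field_simps del: of_nat_Suc)
  then have "fps_nth (urn_deriv ?s ?v (pref_growth_egf \<alpha> \<beta>)) n =
      smult (1 / fact n) (?h (Suc n) - of_nat n * ?s * ?h n - ?v * pderiv (?h n))"
    unfolding urn_deriv_nth pref_growth_egf_nth pderiv_smult by (simp add: smult_diff_right)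
  also have "?h (Suc n) - of_nat n * ?s * ?h n - ?v * pderiv (?h n) = monom 1 \<alpha> * ?h n"
    unfolding pref_growth_sum_Suc by (simp add: algebra_simps)
  also have "smult (1 / fact n) \<dots> = fps_nth (fps_const (monom 1 \<alpha>) * pref_growth_egf \<alpha> \<beta>) n"
    by (simp add: pref_growth_egf_nth)
  finally show "fps_nth (urn_deriv ?s ?v (pref_growth_egf \<alpha> \<beta>)) n =
      fps_nth (fps_const (monom 1 \<alpha>) * pref_growth_egf \<alpha> \<beta>) n" .
qed

text \<open>The equation is multiplied by \<open>x\<^bsup>\<alpha>\<^esup>\<close> to have coefficients in \<open>\<rat>[x, z]\<close>; its left-hand side is then
  no longer annihilated by \<open>L\<close> but an eigenvector over \<open>\<rat>[x]\<close>.\<close>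

lemma pref_growth_egf_equation:
  fixes \<alpha> \<beta> :: nat
  assumes "\<alpha> > 0" and "\<beta> > 0"
  defines "u \<equiv> monom 1 \<alpha> :: rat poly"
    and "A \<equiv> [:1 / of_nat (2 * \<alpha> + \<beta>):]"
    and "b \<equiv> smult (1 / of_nat (\<alpha> + \<beta>)) (1 - monom 1 \<alpha>)"
    and "Y \<equiv> pref_growth_egf \<alpha> \<beta>"
  shows "(fps_const u * fps_X - fps_const (A * u + b)) * Y ^ (2 * \<alpha> + \<beta>) +
    fps_const b * Y ^ \<alpha> + fps_const (A * u) = 0" (is "?G = 0")
proof -
  define \<sigma> where "\<sigma> = 2 * \<alpha> + \<beta>"
  define s where "s = of_nat \<sigma> * u"
  define v where "v = (u * u - u) * monom 1 1"
  \<comment> \<open>\<open>c\<close> is the eigenvalue of \<open>u = x ^ \<alpha>\<close> under L,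
    as \<open>vu\<close> shows; clearing the denominator by \<open>u\<close> turns eigenvalue 0 of
    the left-hand side into \<open>c\<close>.\<close>
  define c where "c = of_nat \<alpha> * u * (1 - u)"
  have uu: "monom 1 (2 * \<alpha>) = u * u"
    by (simp add: u_def mult_monom mult_2)
  have LY: "urn_deriv s v Y = fps_const u * Y"
    using urn_deriv_pref_growth_egf[of \<alpha> \<beta>]
    unfolding s_def v_def uu Y_def \<sigma>_def by (simp add: u_def)
  have sA: "of_nat \<sigma> * A = 1"
    using assms by (simp add: A_def \<sigma>_def of_nat_poly)
  have b: "of_nat (\<alpha> + \<beta>) * b = 1 - u"
    using assms by (simp add: b_def u_def of_nat_poly)
  have vu: "v * pderiv u = - (c * u)"
  proof -
    have "v * pderiv u = (u * u - u) * (of_nat \<alpha> * u)"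
      unfolding v_def mult.assoc using X_times_pderiv_monom[of \<alpha>, where 'a = rat]
      by (simp add: u_def)
    then show ?thesis
      by (simp add: c_def algebra_simps)
  qed
  have vA: "pderiv (A * u) = A * pderiv u"
    by (simp add: A_def pderiv_smult)
  \<comment> \<open>In other words \<open>b * Y ^ \<alpha>\<close> has eigenvalue \<open>c\<close>:
    the \<alpha>-fold eigenvalue \<open>u\<close> of \<open>Y\<close> is compensated by the
    coefficient \<open>b\<close>.\<close>
  have vb: "v * pderiv b = of_nat \<alpha> * u * b - c * b"
  proof -
    have "of_nat (\<alpha> + \<beta>) * pderiv b = - pderiv u"
      using arg_cong[OF b, of pderiv] by (simp add: pderiv_mult pderiv_diff del: of_nat_add)
    then have "of_nat (\<alpha> + \<beta>) * (v * pderiv b) = c * u"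
      using vu by (simp only: mult.left_commute[of _ v] mult_minus_right minus_minus)
    also have "\<dots> = of_nat \<alpha> * u * u * (of_nat (\<alpha> + \<beta>) * b)"
      unfolding b c_def by (simp add: algebra_simps)
    also have "\<dots> = of_nat (\<alpha> + \<beta>) * (of_nat \<alpha> * u * b - c * b)"
      by (simp add: c_def algebra_simps)
    finally show ?thesis
      using assms by (subst (asm) mult_left_cancel) (simp_all del: of_nat_add)
  qed
  define P where "P = fps_const u * fps_X - fps_const (A * u + b)"
  \<comment> \<open>The same compensation for the leading coefficient: \<open>Y ^ \<sigma>\<close>
    contributes \<open>\<sigma> * u\<close>, so \<open>P * Y ^ \<sigma>\<close> has eigenvalue
    \<open>c\<close>.\<close>
  have LP: "urn_deriv s v P + of_nat \<sigma> * fps_const u * P = fps_const c * P"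
  proof -
    have P': "P = fps_const u * fps_X + fps_const (- (A * u + b))"
      by (simp add: P_def)
    have "v * pderiv (A * u + b) = of_nat \<alpha> * u * b - c * (A * u + b)"
      by (simp add: pderiv_add vA distrib_left mult.left_commute[of v] vu vb)
    then have LP': "urn_deriv s v P = fps_const (c * u) * fps_X
        + fps_const u * (1 - fps_const s * fps_X)
        + fps_const (of_nat \<alpha> * u * b - c * (A * u + b))"
      unfolding P' urn_deriv_add urn_deriv_mult urn_deriv_const urn_deriv_X pderiv_minus
      by (simp add: vu)
    \<comment> \<open>This is the coefficient of \<open>z ^ 0\<close> in \<open>LP\<close>. The
      choice of \<open>A\<close> and \<open>b\<close> makes the bracket
      \<open>1 - u - (1 - u)\<close> vanish; the coefficient of \<open>z\<close> agrees because
      \<open>s = of_nat \<sigma> * u\<close>.\<close>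
    have "u + (of_nat \<alpha> * u * b - c * (A * u + b)) - of_nat \<sigma> * u * (A * u + b) =
        u * (1 - u * (of_nat \<sigma> * A) - of_nat (\<alpha> + \<beta>) * b) - c * (A * u + b)"
      by (simp add: \<sigma>_def algebra_simps)
    also have "\<dots> = - (c * (A * u + b))"
      unfolding sA b by simp
    finally have key: "u + (of_nat \<alpha> * u * b - c * (A * u + b)) - of_nat \<sigma> * u * (A * u + b) =
      - (c * (A * u + b))" .
    show ?thesis
    proof (rule fps_ext)
      fix n
      show "fps_nth (urn_deriv s v P + of_nat \<sigma> * fps_const u * P) n = fps_nth (fps_const c * P) n"
        using key unfolding LP' unfolding P_def fps_of_nat[symmetric] fps_const_mult
        by (cases n) (auto simp: s_def fps_X_def algebra_simps)
    qed
  qed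
  have "urn_deriv s v ?G = (urn_deriv s v P + of_nat \<sigma> * fps_const u * P) * Y ^ \<sigma>
      + fps_const (of_nat \<alpha> * u * b - v * pderiv b) * Y ^ \<alpha> - fps_const (v * pderiv (A * u))"
    unfolding P_def[symmetric] \<sigma>_def[symmetric] urn_deriv_add urn_deriv_mult
      urn_deriv_power[OF LY] urn_deriv_const
    by (simp add: fps_of_nat[symmetric] algebra_simps
        flip: fps_const_add fps_const_sub fps_const_mult)
  also have "of_nat \<alpha> * u * b - v * pderiv b = c * b"
    by (simp add: vb)
  also have "v * pderiv (A * u) = - (c * (A * u))"
    unfolding vA mult.left_commute[of v] vu by simp
  finally have LG: "urn_deriv s v ?G = fps_const c * ?G"
    unfolding LP P_def[symmetric] \<sigma>_def[symmetric]
    by (simp add: algebra_simps flip: fps_const_mult fps_const_neg)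
  \<comment> \<open>At \<open>z = 0\<close> the series \<open>Y\<close> equals 1, and the
    coefficients \<open>- (A * u + b)\<close>, \<open>b\<close> and \<open>A * u\<close>
    cancel.\<close>
  have "fps_nth ?G 0 = 0"
    by (simp add: Y_def fps_power_zeroth pref_growth_egf_nth pref_growth_sum_0 flip: one_pCons)
  with LG show ?thesis
    by (rule urn_deriv_eigen_eq_0)
qed

lemma algebraic_pref_growth_egf:
  assumes "\<alpha> > 0" and "\<beta> > 0"
  shows "algebraic_fps (pref_growth_egf \<alpha> \<beta>)"
proof -
  define u :: "rat poly" where "u = monom 1 \<alpha>"
  define A :: "rat poly" where "A = [:1 / of_nat (2 * \<alpha> + \<beta>):]"
  define b where "b = smult (1 / of_nat (\<alpha> + \<beta>)) (1 - u)"
  let ?P = "monom [:- (A * u + b), u:] (2 * \<alpha> + \<beta>) + monom [:b:] \<alpha> + monom [:A * u:] 0"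
  have Au: "A * u \<noteq> 0"
    using assms by (simp add: A_def u_def del: of_nat_add of_nat_mult)
  have eq: "(fps_const u * fps_X - fps_const (A * u + b)) * pref_growth_egf \<alpha> \<beta> ^ (2 * \<alpha> + \<beta>) +
      fps_const b * pref_growth_egf \<alpha> \<beta> ^ \<alpha> + fps_const (A * u) = 0"
    using pref_growth_egf_equation[OF assms] by (simp add: u_def A_def b_def)
  have "map_poly fps_of_poly ?P = map_poly fps_of_poly (monom [:- (A * u + b), u:] (2 * \<alpha> + \<beta>))
      + map_poly fps_of_poly (monom [:b:] \<alpha>) + map_poly fps_of_poly (monom [:A * u:] 0)"
    by (rule poly_eqI) (simp add: coeff_map_poly fps_of_poly_add)
  then have "poly (map_poly fps_of_poly ?P) (pref_growth_egf \<alpha> \<beta>) = 0"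
    using eq by (simp add: map_poly_monom poly_monom fps_of_poly_pCons fps_of_poly_const
        algebra_simps flip: fps_const_neg fps_const_add fps_const_sub)
  \<comment> \<open>Since \<alpha> is positive, the other two monomials have positive degree, and
    the nonzero constant term witnesses \<open>?P \<noteq> 0\<close>.\<close>
  moreover have "coeff ?P 0 = [:A * u:]"
    using assms by simp
  then have "?P \<noteq> 0"
    using Au by (metis coeff_0 pCons_eq_0_iff)
  ultimately show ?thesis
    unfolding algebraic_fps_def by blast
qed

section \<open>Transfer of series from polynomials in x to rational functions\<close>

lemma fps_map_to_fract_add:
  "fps_map to_fract (F + G) = fps_map to_fract F + fps_map to_fract G"
  by (rule fps_ext) simp

lemma fps_map_to_fract_diff:
  "fps_map to_fract (F - G) = fps_map to_fract F - fps_map to_fract G"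
  by (rule fps_ext) simp

lemma fps_map_to_fract_mult:
  "fps_map to_fract (F * G) = fps_map to_fract F * fps_map to_fract G"
  by (rule fps_ext) (simp add: fps_mult_nth to_fract_sum)

lemma fps_map_to_fract_const: "fps_map to_fract (fps_const c) = fps_const (to_fract c)"
  by (rule fps_ext) simp

lemma fps_map_to_fract_X: "fps_map to_fract fps_X = fps_X"
  by (rule fps_ext) (simp add: fps_X_def)

lemma fps_map_to_fract_power: "fps_map to_fract (F ^ k) = fps_map to_fract F ^ k"
proof (induction k)
  case 0
  show ?case
    using fps_map_to_fract_const[of 1] by simp
next
  case (Suc k)
  then show ?case
    by (simp add: fps_map_to_fract_mult)
qed

lemma to_fract_of_nat: "to_fract (of_nat n) = of_nat n"
  by (induction n) simp_all

lemma to_fract_power: "to_fract (p ^ n) = to_fract p ^ n"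
  by (induction n) simp_all

theorem theorem2:
  fixes \<alpha> \<beta> :: nat
  assumes "\<alpha> > 0" and "\<beta> > 0"
  shows "algebraic_fps (pref_growth_egf \<alpha> \<beta>) \<and>
    (let x = to_fract [:0, 1:] :: rat poly fract;
         A = 1 / of_nat (2 * \<alpha> + \<beta>);
         B = (x powi (- int \<alpha>) - 1) / of_nat (\<alpha> + \<beta>);
         y = fps_map to_fract (pref_growth_egf \<alpha> \<beta>)
     in (fps_X - fps_const A - fps_const B) * y ^ (2 * \<alpha> + \<beta>) + fps_const B * y ^ \<alpha>
          + fps_const A = 0)"
proof -
  define u :: "rat poly" where "u = monom 1 \<alpha>"
  define A' :: "rat poly" where "A' = [:1 / of_nat (2 * \<alpha> + \<beta>):]"
  define b where "b = smult (1 / of_nat (\<alpha> + \<beta>)) (1 - u)"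
  define x :: "rat poly fract" where "x = to_fract [:0, 1:]"
  define A :: "rat poly fract" where "A = 1 / of_nat (2 * \<alpha> + \<beta>)"
  define B where "B = (x powi (- int \<alpha>) - 1) / of_nat (\<alpha> + \<beta>)"
  define y where "y = fps_map to_fract (pref_growth_egf \<alpha> \<beta>)"
  define n1 :: "rat poly fract" where "n1 = of_nat (2 * \<alpha> + \<beta>)"
  define n2 :: "rat poly fract" where "n2 = of_nat (\<alpha> + \<beta>)"
  have n: "n1 \<noteq> 0" "n2 \<noteq> 0"
    using assms by (simp_all add: n1_def n2_def del: of_nat_add of_nat_mult)
  have x: "x \<noteq> 0"
    by (simp add: x_def)
  have u: "to_fract u = x ^ \<alpha>"
    by (simp add: u_def x_def monom_altdef to_fract_power)
  have "of_nat (2 * \<alpha> + \<beta>) * A' = 1"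
    using assms by (simp add: A'_def of_nat_poly)
  then have "n1 * to_fract A' = 1"
    unfolding n1_def by (metis to_fract_1 to_fract_mult to_fract_of_nat)
  then have A: "to_fract A' = A"
    unfolding A_def n1_def[symmetric] using n by (simp add: field_simps)
  have "of_nat (\<alpha> + \<beta>) * b = 1 - u"
    using assms by (simp add: b_def of_nat_poly)
  then have "n2 * to_fract b = 1 - x ^ \<alpha>"
    unfolding n2_def u[symmetric] by (metis to_fract_1 to_fract_diff to_fract_mult to_fract_of_nat)
  \<comment> \<open>Multiplying \<open>B\<close> by \<open>x ^ \<alpha>\<close> clears its negative
    power of \<open>x\<close>; this identifies the polynomial \<open>b\<close> as
    \<open>x ^ \<alpha> * B\<close>.\<close>
  also have "\<dots> = n2 * (x ^ \<alpha> * B)"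
    unfolding B_def n2_def[symmetric] using n x by (simp add: power_int_minus field_simps)
  finally have b: "to_fract b = x ^ \<alpha> * B"
    using n by simp
  have eq: "(fps_const u * fps_X - fps_const (A' * u + b)) * pref_growth_egf \<alpha> \<beta> ^ (2 * \<alpha> + \<beta>) +
      fps_const b * pref_growth_egf \<alpha> \<beta> ^ \<alpha> + fps_const (A' * u) = 0"
    using pref_growth_egf_equation[OF assms] by (simp add: u_def A'_def b_def)
  define w where "w = x ^ \<alpha>"
  have "(fps_const w * fps_X - fps_const (A * w + w * B)) * y ^ (2 * \<alpha> + \<beta>) +
      fps_const (w * B) * y ^ \<alpha> + fps_const (A * w) = fps_map to_fract 0"
    unfolding eq[symmetric] fps_map_to_fract_add fps_map_to_fract_diff fps_map_to_fract_mult
      fps_map_to_fract_const fps_map_to_fract_X fps_map_to_fract_power y_def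
      to_fract_add to_fract_mult u A b w_def ..
  also have "fps_map to_fract 0 = 0"
    by (rule fps_ext) simp
  \<comment> \<open>All coefficients share the factor \<open>w = x ^ \<alpha>\<close>, which is
    nonzero and cancels in the integral domain of power series.\<close>
  finally have "fps_const w * ((fps_X - fps_const A - fps_const B) * y ^ (2 * \<alpha> + \<beta>) +
      fps_const B * y ^ \<alpha> + fps_const A) = 0"
    unfolding fps_const_mult[symmetric] fps_const_add[symmetric] by (simp only: algebra_simps)
  moreover have "fps_const w \<noteq> 0"
    using x by (simp add: w_def)
  ultimately have "(fps_X - fps_const A - fps_const B) * y ^ (2 * \<alpha> + \<beta>) +
      fps_const B * y ^ \<alpha> + fps_const A = 0"
    by (simp only: mult_eq_0_iff simp_thms)
  with algebraic_pref_growth_egf[OF assms] show ?thesis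
    unfolding Let_def A_def B_def x_def y_def by blast
qed

end
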